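(* Let $\mathbf R=(R,+,\cdot,0,1)$ be a specific RLSE and let $\mathbf L=(L,\vee,\wedge,{}',0,1)$ be an orthomodular lattice. Then the following hold: (i) $\mathbb L(\mathbf R)$ is an orthomodular lattice; (ii) $\mathbb R(\mathbf L)$ is a specific RLSE; (iii) $\mathbb R\big(\mathbb L(\mathbf R)\big)=\mathbf R$; (iv) $\mathbb L\big(\mathbb R(\mathbf L)\big)=\mathbf L$.
   Context: A ring-like structure of events (RLSE) is an algebra $(R,+,\cdot,0,1)$ of type $(2,2,0,0)$ such that $(R,\cdot,0,1)$ is a bounded meet-semilattice (i.e. $\cdot$ is associative, commutative and idempotent, $x0=0$ and $x1=x$ for all $x$) and the following hold for all $x,y\in R$ (multiplication binds more strongly than addition): (R1) $x+y=y+x$; (R2) $(xy+1)(x+1)+1=x$; (R3) $\big((xy+1)x+1\big)x=xy$; (R4) $xy+(x+1)=(xy+1)x+1$. An RLSE is called specific if in addition (R5) $x+y=x(y+1)+(x+1)y$ for all $x,y\in R$. For an algebra $\mathbf R=(R,+,\cdot,0,1)$ of type $(2,2,0,0)$, $\mathbb L(\mathbf R)$ denotes the algebra $(R,\vee,\wedge,{}',0,1)$ with $x\vee y:=(x+1)(y+1)+1$, $x\wedge y:=xy$, $x':=x+1$. For an algebra $\mathbf L=(L,\vee,\wedge,{}',0,1)$ of type $(2,2,1,0,0)$, $\mathbb R(\mathbf L)$ denotes the algebra $(L,+,\cdot,0,1)$ with $x+y:=(x\wedge y')\vee(x'\wedge y)$ and $xy:=x\wedge y$. An orthomodular lattice is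 a bounded lattice with an antitone involution $'$ that is a complementation, such that $x\le y$ implies $y=x\vee(y\wedge x')$. *)

theory Defs
  imports
    "HOL-Algebra.Congruence"
    "HOL-Library.FuncSet"
    "HOL-Library.Complemented_Lattices"
begin

text \<open>
  An algebra has an explicit carrier set. A unary or binary operation on a carrier \<open>A\<close> is an
  element of \<open>A \<rightarrow>\<^sub>E A\<close> or \<open>A \<rightarrow>\<^sub>E A \<rightarrow>\<^sub>E A\<close>: it is closed on \<open>A\<close> and has the
  dummy value \<open>undefined\<close> outside \<open>A\<close>. Since operations are thus determined by their values on the
  carrier, equality of such records is exactly equality of algebras.
\<close>

record 'a ringlike_alg = "'a partial_object" +
  rl_add :: "'a \<Rightarrow> 'a \<Rightarrow> 'a" (infixl \<open>\<oplus>\<index>\<close> 65)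
  rl_mult :: "'a \<Rightarrow> 'a \<Rightarrow> 'a" (infixl \<open>\<otimes>\<index>\<close> 70)
  rl_zero :: 'a (\<open>\<zero>\<index>\<close>)
  rl_one :: 'a (\<open>\<one>\<index>\<close>)

record 'a ortho_alg = "'a partial_object" +
  ol_join :: "'a \<Rightarrow> 'a \<Rightarrow> 'a" (infixl \<open>\<squnion>\<index>\<close> 65)
  ol_meet :: "'a \<Rightarrow> 'a \<Rightarrow> 'a" (infixl \<open>\<sqinter>\<index>\<close> 70)
  ol_compl :: "'a \<Rightarrow> 'a" (\<open>\<sim>\<index> _\<close> [81] 80)
  ol_bot :: 'a (\<open>\<bottom>\<index>\<close>)
  ol_top :: 'a (\<open>\<top>\<index>\<close>)

locale rlse =
  fixes R :: "'a ringlike_alg" (structure)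
  assumes add_op: "rl_add R \<in> carrier R \<rightarrow>\<^sub>E carrier R \<rightarrow>\<^sub>E carrier R"
    and mult_op: "rl_mult R \<in> carrier R \<rightarrow>\<^sub>E carrier R \<rightarrow>\<^sub>E carrier R"
    and zero_closed: "\<zero> \<in> carrier R"
    and one_closed: "\<one> \<in> carrier R"
    and mult_assoc: "\<lbrakk>x \<in> carrier R; y \<in> carrier R; z \<in> carrier R\<rbrakk>
          \<Longrightarrow> (x \<otimes> y) \<otimes> z = x \<otimes> (y \<otimes> z)"
    and mult_comm: "\<lbrakk>x \<in> carrier R; y \<in> carrier R\<rbrakk> \<Longrightarrow> x \<otimes> y = y \<otimes> x"
    and mult_idem: "x \<in> carrier R \<Longrightarrow> x \<otimes> x = x"
    and mult_zero: "x \<in> carrier R \<Longrightarrow> x \<otimes> \<zero> = \<zero>"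
    and mult_one: "x \<in> carrier R \<Longrightarrow> x \<otimes> \<one> = x"
    and R1: "\<lbrakk>x \<in> carrier R; y \<in> carrier R\<rbrakk> \<Longrightarrow> x \<oplus> y = y \<oplus> x"
    and R2: "\<lbrakk>x \<in> carrier R; y \<in> carrier R\<rbrakk>
          \<Longrightarrow> (x \<otimes> y \<oplus> \<one>) \<otimes> (x \<oplus> \<one>) \<oplus> \<one> = x"
    and R3: "\<lbrakk>x \<in> carrier R; y \<in> carrier R\<rbrakk>
          \<Longrightarrow> ((x \<otimes> y \<oplus> \<one>) \<otimes> x \<oplus> \<one>) \<otimes> x = x \<otimes> y"
    and R4: "\<lbrakk>x \<in> carrier R; y \<in> carrier R\<rbrakk>
          \<Longrightarrow> x \<otimes> y \<oplus> (x \<oplus> \<one>) = (x \<otimes> y \<oplus> \<one>) \<otimes> x \<oplus> \<one>"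

locale specific_rlse = rlse +
  assumes R5: "\<lbrakk>x \<in> carrier R; y \<in> carrier R\<rbrakk>
          \<Longrightarrow> x \<oplus> y = x \<otimes> (y \<oplus> \<one>) \<oplus> (x \<oplus> \<one>) \<otimes> y"

definition ol_le :: "'a ortho_alg \<Rightarrow> 'a \<Rightarrow> 'a \<Rightarrow> bool" (infix \<open>\<sqsubseteq>\<index>\<close> 50)
  where "x \<sqsubseteq>\<^bsub>L\<^esub> y \<longleftrightarrow> x \<sqinter>\<^bsub>L\<^esub> y = x"

locale orthomodular_alg =
  fixes L :: "'a ortho_alg" (structure)
  assumes join_op: "ol_join L \<in> carrier L \<rightarrow>\<^sub>E carrier L \<rightarrow>\<^sub>E carrier L"
    and meet_op: "ol_meet L \<in> carrier L \<rightarrow>\<^sub>E carrier L \<rightarrow>\<^sub>E carrier L"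
    and compl_op: "ol_compl L \<in> carrier L \<rightarrow>\<^sub>E carrier L"
    and bot_closed: "\<bottom> \<in> carrier L"
    and top_closed: "\<top> \<in> carrier L"
    and join_assoc: "\<lbrakk>x \<in> carrier L; y \<in> carrier L; z \<in> carrier L\<rbrakk>
          \<Longrightarrow> (x \<squnion> y) \<squnion> z = x \<squnion> (y \<squnion> z)"
    and meet_assoc: "\<lbrakk>x \<in> carrier L; y \<in> carrier L; z \<in> carrier L\<rbrakk>
          \<Longrightarrow> (x \<sqinter> y) \<sqinter> z = x \<sqinter> (y \<sqinter> z)"
    and join_comm: "\<lbrakk>x \<in> carrier L; y \<in> carrier L\<rbrakk> \<Longrightarrow> x \<squnion> y = y \<squnion> x"
    and meet_comm: "\<lbrakk>x \<in> carrier L; y \<in> carrier L\<rbrakk> \<Longrightarrow> x \<sqinter> y = y \<sqinter> x"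
    and join_absorb: "\<lbrakk>x \<in> carrier L; y \<in> carrier L\<rbrakk> \<Longrightarrow> x \<squnion> (x \<sqinter> y) = x"
    and meet_absorb: "\<lbrakk>x \<in> carrier L; y \<in> carrier L\<rbrakk> \<Longrightarrow> x \<sqinter> (x \<squnion> y) = x"
    and bot_least: "x \<in> carrier L \<Longrightarrow> \<bottom> \<sqsubseteq> x"
    and top_greatest: "x \<in> carrier L \<Longrightarrow> x \<sqsubseteq> \<top>"
    and compl_antitone: "\<lbrakk>x \<in> carrier L; y \<in> carrier L; x \<sqsubseteq> y\<rbrakk> \<Longrightarrow> \<sim> y \<sqsubseteq> \<sim> x"
    and compl_involution: "x \<in> carrier L \<Longrightarrow> \<sim> (\<sim> x) = x"
    and join_compl: "x \<in> carrier L \<Longrightarrow> x \<squnion> \<sim> x = \<top>"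
    and meet_compl: "x \<in> carrier L \<Longrightarrow> x \<sqinter> \<sim> x = \<bottom>"
    and orthomodular: "\<lbrakk>x \<in> carrier L; y \<in> carrier L; x \<sqsubseteq> y\<rbrakk>
          \<Longrightarrow> y = x \<squnion> (y \<sqinter> \<sim> x)"

definition lattice_of :: "'a ringlike_alg \<Rightarrow> 'a ortho_alg" (\<open>\<bbbL>\<close>)
  where "\<bbbL> R = \<lparr>
    carrier = carrier R,
    ol_join = (\<lambda>x\<in>carrier R. \<lambda>y\<in>carrier R.
      (x \<oplus>\<^bsub>R\<^esub> \<one>\<^bsub>R\<^esub>) \<otimes>\<^bsub>R\<^esub> (y \<oplus>\<^bsub>R\<^esub> \<one>\<^bsub>R\<^esub>) \<oplus>\<^bsub>R\<^esub> \<one>\<^bsub>R\<^esub>),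
    ol_meet = (\<lambda>x\<in>carrier R. \<lambda>y\<in>carrier R. x \<otimes>\<^bsub>R\<^esub> y),
    ol_compl = (\<lambda>x\<in>carrier R. x \<oplus>\<^bsub>R\<^esub> \<one>\<^bsub>R\<^esub>),
    ol_bot = \<zero>\<^bsub>R\<^esub>,
    ol_top = \<one>\<^bsub>R\<^esub>\<rparr>"

definition ringlike_of :: "'a ortho_alg \<Rightarrow> 'a ringlike_alg" (\<open>\<bbbR>\<close>)
  where "\<bbbR> L = \<lparr>
    carrier = carrier L,
    rl_add = (\<lambda>x\<in>carrier L. \<lambda>y\<in>carrier L.
      (x \<sqinter>\<^bsub>L\<^esub> \<sim>\<^bsub>L\<^esub> y) \<squnion>\<^bsub>L\<^esub> (\<sim>\<^bsub>L\<^esub> x \<sqinter>\<^bsub>L\<^esub> y)),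
    rl_mult = (\<lambda>x\<in>carrier L. \<lambda>y\<in>carrier L. x \<sqinter>\<^bsub>L\<^esub> y),
    rl_zero = \<bottom>\<^bsub>L\<^esub>,
    rl_one = \<top>\<^bsub>L\<^esub>\<rparr>"

text \<open>
  On algebras whose carrier is a whole type, \<^locale>\<open>orthomodular_alg\<close> coincides with the type
  class \<^class>\<open>orthomodular_lattice\<close> of the library. The latter cannot be used directly here
  because it does not allow a carrier set.
\<close>

lemma orthomodular_alg_UNIV_iff:
  fixes L :: "'a ortho_alg"
  assumes "carrier L = UNIV"
  shows "orthomodular_alg L \<longleftrightarrow>
    class.orthomodular_lattice (\<lambda>x y. x \<sqinter>\<^bsub>L\<^esub> \<sim>\<^bsub>L\<^esub> y) (ol_compl L) (ol_meet L)
      (ol_le L) (\<lambda>x y. x \<sqsubseteq>\<^bsub>L\<^esub> y \<and> x \<noteq> y) (ol_join L) \<bottom>\<^bsub>L\<^esub> \<top>\<^bsub>L\<^esub>"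
    (is "_ \<longleftrightarrow> ?C")
proof
  assume "orthomodular_alg L"
  then interpret orthomodular_alg L .
  note [simp] = assms
  have ji: "x \<squnion>\<^bsub>L\<^esub> y = y" if "x \<sqinter>\<^bsub>L\<^esub> y = x" for x y
    using join_absorb[of y x] that join_comm[of x y] meet_comm[of x y] by simp
  have ij: "x \<sqinter>\<^bsub>L\<^esub> y = x" if "x \<squnion>\<^bsub>L\<^esub> y = y" for x y
    using meet_absorb[of x y] that by simp
  have idem: "x \<sqinter>\<^bsub>L\<^esub> x = x" for x
    using meet_absorb[of x "x \<sqinter>\<^bsub>L\<^esub> x"] join_absorb[of x x] by simp
  have l1: "(x \<sqinter>\<^bsub>L\<^esub> y) \<sqinter>\<^bsub>L\<^esub> x = x \<sqinter>\<^bsub>L\<^esub> y" for x y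
    using meet_assoc[of x y x] meet_assoc[of x x y] meet_comm[of x y] idem[of x] by simp
  have l2: "(x \<sqinter>\<^bsub>L\<^esub> y) \<sqinter>\<^bsub>L\<^esub> y = x \<sqinter>\<^bsub>L\<^esub> y" for x y
    using meet_assoc[of x y y] idem[of y] by simp
  show ?C
  proof (unfold_locales, goal_cases)
    case (1 x y)
    then show ?case
      unfolding ol_le_def using meet_comm[of x y] by auto
  next
    case (2 x) then show ?case unfolding ol_le_def by (rule idem)
  next
    case (3 x y z) then show ?case
      unfolding ol_le_def using meet_assoc[of x y z] by simp
  next
    case (4 x y) then show ?case
      unfolding ol_le_def using meet_comm[of x y] by simp
  next
    case (5 x y) then show ?case unfolding ol_le_def by (rule l1)
  next
    case (6 x y) then show ?case unfolding ol_le_def by (rule l2)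
  next
    case (7 x y z) then show ?case
      unfolding ol_le_def using meet_assoc[of x y z] by simp
  next
    case (8 x y) then show ?case unfolding ol_le_def using meet_absorb[of x y] by simp
  next
    case (9 y x) then show ?case
      unfolding ol_le_def using meet_absorb[of y x] join_comm[of x y] by simp
  next
    case (10 y x z) then show ?case
      unfolding ol_le_def using join_assoc[of y z x] ji[of y x] ji[of z x] by (intro ij) simp
  next
    case (11 x) then show ?case using bot_least[of x] by simp
  next
    case (12 x) then show ?case using top_greatest[of x] by simp
  next
    case (13 x) then show ?case using meet_compl[of x] by simp
  next
    case (14 x) then show ?case using join_compl[of x] by simp
  next
    case (15 x y) then show ?case by simp
  next
    case (16 x) then show ?case using compl_involution[of x] by simp
  next
    case (17 x y) then show ?case using compl_antitone[of x y] by simp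
  next
    case (18 x y) then show ?case
      using orthomodular[of x y] meet_comm[of y "\<sim>\<^bsub>L\<^esub> x"] by simp
  qed
next
  assume ?C
  then interpret C: orthomodular_lattice "\<lambda>x y. x \<sqinter>\<^bsub>L\<^esub> \<sim>\<^bsub>L\<^esub> y" "ol_compl L" "ol_meet L"
    "ol_le L" "\<lambda>x y. x \<sqsubseteq>\<^bsub>L\<^esub> y \<and> x \<noteq> y" "ol_join L" "\<bottom>\<^bsub>L\<^esub>" "\<top>\<^bsub>L\<^esub>" .
  show "orthomodular_alg L"
    by unfold_locales
      (auto simp: assms C.sup.assoc C.inf.assoc C.ortho_antimono C.inf_sup_aci C.orthomodular
        intro: C.sup.commute C.inf.commute,
       (metis C.orthomodular C.inf.commute)+)
qed

end

theory Submission
  imports Defs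
begin

text \<open>
  Write \<open>x'\<close> for \<open>x + 1\<close>. In an RLSE, (R2) says that \<open>'\<close> is an antitone involution, and for
  \<open>y \<le> x\<close> (R3) reads \<open>(y'x)'x = y\<close>, which is the De Morgan dual of the orthomodular law; its case
  \<open>y = 0\<close> gives \<open>x'x = 0\<close>. In both structures addition is join on orthogonal elements: in an RLSE
  this is (R4), and in an orthomodular lattice it is immediate from the definition of \<open>+\<close>.
  Hence (R5) says precisely that \<open>x + y = xy' \<or> x'y\<close>.
\<close>

section \<open>Curried binary operations on a carrier\<close>

lemma funcset2_mem:
  assumes "f \<in> A \<rightarrow>\<^sub>E B \<rightarrow>\<^sub>E C" "x \<in> A" "y \<in> B"
  shows "f x y \<in> C"
  using assms by (meson PiE_mem)

text \<open>Extensionality for operations with a fixed default outside the carrier. It reduces the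
  two equalities of algebras to pointwise computations with carrier elements.\<close>

lemma funcset2_eqI:
  assumes "f \<in> A \<rightarrow>\<^sub>E B \<rightarrow>\<^sub>E C" "g \<in> A \<rightarrow>\<^sub>E B \<rightarrow>\<^sub>E C"
    and "\<And>x y. \<lbrakk>x \<in> A; y \<in> B\<rbrakk> \<Longrightarrow> f x y = g x y"
  shows "f = g"
proof (rule PiE_ext[OF assms(1,2)])
  fix x assume x: "x \<in> A"
  show "f x = g x"
    by (rule PiE_ext[OF PiE_mem[OF assms(1) x] PiE_mem[OF assms(2) x]]) (rule assms(3)[OF x])
qed

lemma restrict2_mem:
  assumes "\<And>x y. \<lbrakk>x \<in> A; y \<in> B\<rbrakk> \<Longrightarrow> f x y \<in> C"
  shows "(\<lambda>x\<in>A. \<lambda>y\<in>B. f x y) \<in> A \<rightarrow>\<^sub>E B \<rightarrow>\<^sub>E C"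
  using assms by auto

section \<open>From an RLSE to an orthomodular lattice\<close>

context rlse
begin

lemma add_closed [simp]: "\<lbrakk>x \<in> carrier R; y \<in> carrier R\<rbrakk> \<Longrightarrow> x \<oplus> y \<in> carrier R"
  by (rule funcset2_mem[OF add_op])

lemma mult_closed [simp]: "\<lbrakk>x \<in> carrier R; y \<in> carrier R\<rbrakk> \<Longrightarrow> x \<otimes> y \<in> carrier R"
  by (rule funcset2_mem[OF mult_op])

declare zero_closed [simp] one_closed [simp] mult_idem [simp] mult_zero [simp] mult_one [simp]

text \<open>For \<open>y = 1\<close> the product in (R2) becomes \<open>(x + 1)(x + 1)\<close>,
  which idempotence reduces to \<open>x + 1\<close>.\<close>

lemma add_one_add_one [simp]: "x \<in> carrier R \<Longrightarrow> x \<oplus> \<one> \<oplus> \<one> = x"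
  using R2[of x \<one>] by simp

text \<open>Adding 1 to both sides of (R2) and cancelling by involution gives this. Since the
  elements below \<open>x\<close> are exactly the products \<open>xy\<close>, it expresses that
  \<open>'\<close> is antitone.\<close>

lemma mult_add_one_antitone:
  assumes "x \<in> carrier R" "y \<in> carrier R"
  shows "(x \<otimes> y \<oplus> \<one>) \<otimes> (x \<oplus> \<one>) = x \<oplus> \<one>"
  using R2[OF assms] assms by (metis add_closed add_one_add_one mult_closed one_closed)

text \<open>The element \<open>1 + 1\<close> has complement 1 by involution, so antitony at
  \<open>1 + 1\<close> and 0 collapses to \<open>(0 + 1)1 = 1\<close>.\<close>

lemma zero_add_one [simp]: "\<zero> \<oplus> \<one> = \<one>"
  using mult_add_one_antitone[of "\<one> \<oplus> \<one>" \<zero>] by simp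

lemma one_add_one [simp]: "\<one> \<oplus> \<one> = \<zero>"
  using add_one_add_one[of \<zero>] by simp

lemma add_one_mult_self: "x \<in> carrier R \<Longrightarrow> (x \<oplus> \<one>) \<otimes> x = \<zero>"
  using R3[of x \<zero>] by (simp add: mult_comm[of \<one> x])

text \<open>The hypothesis says \<open>a \<le> b'\<close>, so (R4) at \<open>b'\<close> and
  \<open>a\<close> simplifies to this; the right-hand side is the join of
  \<open>\<bbbL> R\<close>.\<close>

lemma add_orthogonal:
  assumes "a \<in> carrier R" "b \<in> carrier R" "(b \<oplus> \<one>) \<otimes> a = a"
  shows "a \<oplus> b = (a \<oplus> \<one>) \<otimes> (b \<oplus> \<one>) \<oplus> \<one>"
  using R4[of "b \<oplus> \<one>" a] assms by simp

lemma lattice_of_simps: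
  "carrier (\<bbbL> R) = carrier R"
  "\<bottom>\<^bsub>\<bbbL> R\<^esub> = \<zero>"
  "\<top>\<^bsub>\<bbbL> R\<^esub> = \<one>"
  "\<lbrakk>x \<in> carrier R; y \<in> carrier R\<rbrakk> \<Longrightarrow> x \<squnion>\<^bsub>\<bbbL> R\<^esub> y = (x \<oplus> \<one>) \<otimes> (y \<oplus> \<one>) \<oplus> \<one>"
  "\<lbrakk>x \<in> carrier R; y \<in> carrier R\<rbrakk> \<Longrightarrow> x \<sqinter>\<^bsub>\<bbbL> R\<^esub> y = x \<otimes> y"
  "x \<in> carrier R \<Longrightarrow> \<sim>\<^bsub>\<bbbL> R\<^esub> x = x \<oplus> \<one>"
  by (simp_all add: lattice_of_def)

lemma orthomodular_alg_lattice_of: "orthomodular_alg (\<bbbL> R)"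
proof (unfold_locales, unfold ol_le_def lattice_of_simps(1-3), goal_cases)
  case 1 then show ?case unfolding lattice_of_def by (simp add: restrict2_mem)
next
  case 2 then show ?case unfolding lattice_of_def by (simp add: restrict2_mem)
next
  case 3 then show ?case unfolding lattice_of_def by auto
next
  case (6 x y z) then show ?case by (simp add: lattice_of_simps mult_assoc)
next
  case (7 x y z) then show ?case by (simp add: lattice_of_simps mult_assoc)
next
  case (8 x y) then show ?case by (simp add: lattice_of_simps mult_comm)
next
  case (9 x y) then show ?case by (simp add: lattice_of_simps mult_comm)
next
  \<comment> \<open>Through De Morgan, both absorption laws are antitony: at \<open>x\<close>,
    \<open>y\<close> for this one and at \<open>x'\<close>, \<open>y'\<close> for the next.\<close>
  case (10 x y) then show ?case
    using mult_add_one_antitone[of x y] by (simp add: lattice_of_simps mult_comm[of "x \<oplus> \<one>"])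
next
  case (11 x y) then show ?case
    using mult_add_one_antitone[of "x \<oplus> \<one>" "y \<oplus> \<one>"] by (simp add: lattice_of_simps mult_comm[of x])
next
  case (12 x) then show ?case by (simp add: lattice_of_simps mult_comm[of \<zero>])
next
  case (13 x) then show ?case by (simp add: lattice_of_simps)
next
  case (14 x y) then show ?case
    using mult_add_one_antitone[of y x] by (simp add: lattice_of_simps mult_comm)
next
  case (15 x) then show ?case by (simp add: lattice_of_simps)
next
  case (16 x) then show ?case
    using add_one_mult_self[of "x \<oplus> \<one>"] by (simp add: lattice_of_simps mult_comm)
next
  case (17 x) then show ?case
    using add_one_mult_self[of x] by (simp add: lattice_of_simps mult_comm)
next
  case (18 x y)
  then have xy: "x \<otimes> y = x" by (simp add: lattice_of_simps)
  have "(x \<oplus> \<one>) \<otimes> (y \<oplus> \<one>) = y \<oplus> \<one>"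
    using mult_add_one_antitone[of y x] 18 xy by (simp add: mult_comm)
  \<comment> \<open>(R3) is the dual law, so it is applied to the pair \<open>y' \<le> x'\<close>;
    complementing the result yields the orthomodular law for \<open>x \<le> y\<close>.\<close>
  then have "(y \<otimes> (x \<oplus> \<one>) \<oplus> \<one>) \<otimes> (x \<oplus> \<one>) = y \<oplus> \<one>"
    using R3[of "x \<oplus> \<one>" "y \<oplus> \<one>"] 18 by simp
  then have "(x \<oplus> \<one>) \<otimes> (y \<otimes> (x \<oplus> \<one>) \<oplus> \<one>) \<oplus> \<one> = y"
    using 18 by (simp add: mult_comm)
  then show ?case using 18 by (simp add: lattice_of_simps)
qed simp_all

end

section \<open>Recovering a specific RLSE from its lattice\<close>

context specific_rlse
begin

lemma add_eq_join:
  assumes x: "x \<in> carrier R" and y: "y \<in> carrier R"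
  shows "x \<oplus> y = (x \<otimes> (y \<oplus> \<one>) \<oplus> \<one>) \<otimes> ((x \<oplus> \<one>) \<otimes> y \<oplus> \<one>) \<oplus> \<one>"
proof -
  \<comment> \<open>The summands in (R5) are orthogonal because
    \<open>xy' \<le> x \<le> (x'y)'\<close>; this is the second inequality.\<close>
  have "((x \<oplus> \<one>) \<otimes> y \<oplus> \<one>) \<otimes> x = x"
    using mult_add_one_antitone[of "x \<oplus> \<one>" y] x y by simp
  then have "((x \<oplus> \<one>) \<otimes> y \<oplus> \<one>) \<otimes> (x \<otimes> (y \<oplus> \<one>)) = x \<otimes> (y \<oplus> \<one>)"
    using mult_assoc[of "(x \<oplus> \<one>) \<otimes> y \<oplus> \<one>" x "y \<oplus> \<one>"] x y by simp
  then show ?thesis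
    using R5[OF x y] add_orthogonal[of "x \<otimes> (y \<oplus> \<one>)" "(x \<oplus> \<one>) \<otimes> y"] x y by simp
qed

lemma ringlike_of_lattice_of: "\<bbbR> (\<bbbL> R) = R"
proof -
  have "rl_add (\<bbbR> (\<bbbL> R)) = rl_add R"
    unfolding ringlike_of_def
    by (rule funcset2_eqI[OF _ add_op])
      (simp_all add: lattice_of_simps add_eq_join[symmetric] restrict2_mem)
  moreover have "rl_mult (\<bbbR> (\<bbbL> R)) = rl_mult R"
    unfolding ringlike_of_def
    by (rule funcset2_eqI[OF _ mult_op]) (simp_all add: lattice_of_simps restrict2_mem)
  ultimately show ?thesis
    by (simp add: ringlike_of_def lattice_of_simps)
qed

end

section \<open>Order and De Morgan laws in an orthomodular lattice\<close>

context orthomodular_alg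
begin

lemma join_closed [simp]: "\<lbrakk>x \<in> carrier L; y \<in> carrier L\<rbrakk> \<Longrightarrow> x \<squnion> y \<in> carrier L"
  by (rule funcset2_mem[OF join_op])

lemma meet_closed [simp]: "\<lbrakk>x \<in> carrier L; y \<in> carrier L\<rbrakk> \<Longrightarrow> x \<sqinter> y \<in> carrier L"
  by (rule funcset2_mem[OF meet_op])

lemma compl_closed [simp]: "x \<in> carrier L \<Longrightarrow> \<sim> x \<in> carrier L"
  using compl_op by (rule PiE_mem)

declare bot_closed [simp] top_closed [simp] compl_involution [simp]

text \<open>In \<open>x \<sqinter> (x \<squnion> (x \<sqinter> x)) = x\<close> the inner join
  collapses to \<open>x\<close> by the other absorption law.\<close>

lemma meet_idem [simp]: "x \<in> carrier L \<Longrightarrow> x \<sqinter> x = x"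
  using meet_absorb[of x "x \<sqinter> x"] join_absorb[of x x] by simp

lemma meet_top [simp]: "x \<in> carrier L \<Longrightarrow> x \<sqinter> \<top> = x"
  using top_greatest[of x] by (simp add: ol_le_def)

lemma bot_meet [simp]: "x \<in> carrier L \<Longrightarrow> \<bottom> \<sqinter> x = \<bottom>"
  using bot_least[of x] by (simp add: ol_le_def)

lemma meet_bot [simp]: "x \<in> carrier L \<Longrightarrow> x \<sqinter> \<bottom> = \<bottom>"
  using bot_meet[of x] meet_comm[of x \<bottom>] by simp

lemma bot_join [simp]: "x \<in> carrier L \<Longrightarrow> \<bottom> \<squnion> x = x"
  using join_absorb[of x \<bottom>] join_comm[of x \<bottom>] by simp

lemma compl_top [simp]: "\<sim> \<top> = \<bottom>"
  using meet_compl[of \<top>] meet_comm[of "\<sim> \<top>" \<top>] meet_top[of "\<sim> \<top>"] by simp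

lemma le_iff_join: "\<lbrakk>x \<in> carrier L; y \<in> carrier L\<rbrakk> \<Longrightarrow> x \<sqsubseteq> y \<longleftrightarrow> x \<squnion> y = y"
  unfolding ol_le_def
  by (metis join_absorb join_comm meet_absorb meet_comm)

lemma le_trans:
  "\<lbrakk>x \<in> carrier L; y \<in> carrier L; z \<in> carrier L; x \<sqsubseteq> y; y \<sqsubseteq> z\<rbrakk> \<Longrightarrow> x \<sqsubseteq> z"
  unfolding ol_le_def by (metis meet_assoc)

lemma le_antisym: "\<lbrakk>x \<in> carrier L; y \<in> carrier L; x \<sqsubseteq> y; y \<sqsubseteq> x\<rbrakk> \<Longrightarrow> x = y"
  unfolding ol_le_def by (metis meet_comm)

lemma meet_le1: "\<lbrakk>x \<in> carrier L; y \<in> carrier L\<rbrakk> \<Longrightarrow> x \<sqinter> y \<sqsubseteq> x"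
  unfolding ol_le_def by (metis meet_assoc meet_comm meet_idem)

lemma meet_le2: "\<lbrakk>x \<in> carrier L; y \<in> carrier L\<rbrakk> \<Longrightarrow> x \<sqinter> y \<sqsubseteq> y"
  using meet_le1[of y x] by (simp add: meet_comm)

lemma join_ge1: "\<lbrakk>x \<in> carrier L; y \<in> carrier L\<rbrakk> \<Longrightarrow> x \<sqsubseteq> x \<squnion> y"
  unfolding ol_le_def by (rule meet_absorb)

lemma join_ge2: "\<lbrakk>x \<in> carrier L; y \<in> carrier L\<rbrakk> \<Longrightarrow> y \<sqsubseteq> x \<squnion> y"
  using join_ge1[of y x] by (simp add: join_comm)

lemma meet_greatest:
  "\<lbrakk>x \<in> carrier L; y \<in> carrier L; z \<in> carrier L; z \<sqsubseteq> x; z \<sqsubseteq> y\<rbrakk> \<Longrightarrow> z \<sqsubseteq> x \<sqinter> y"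
  unfolding ol_le_def by (metis meet_assoc)

text \<open>An antitone involution is a dual order isomorphism, so it turns least upper bounds into
  greatest lower bounds.\<close>

lemma compl_join:
  assumes x: "x \<in> carrier L" and y: "y \<in> carrier L"
  shows "\<sim> (x \<squnion> y) = \<sim> x \<sqinter> \<sim> y"
proof (rule le_antisym)
  show "\<sim> (x \<squnion> y) \<sqsubseteq> \<sim> x \<sqinter> \<sim> y"
    using x y by (intro meet_greatest compl_antitone join_ge1 join_ge2) simp_all
  have "x \<sqsubseteq> \<sim> (\<sim> x \<sqinter> \<sim> y)" "y \<sqsubseteq> \<sim> (\<sim> x \<sqinter> \<sim> y)"
    using compl_antitone[OF _ _ meet_le1, of "\<sim> x" "\<sim> y"]
      compl_antitone[OF _ _ meet_le2, of "\<sim> x" "\<sim> y"] x y by simp_all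
  then have "x \<squnion> y \<sqsubseteq> \<sim> (\<sim> x \<sqinter> \<sim> y)"
    using x y by (simp add: le_iff_join join_assoc)
  then show "\<sim> x \<sqinter> \<sim> y \<sqsubseteq> \<sim> (x \<squnion> y)"
    using compl_antitone[of "x \<squnion> y" "\<sim> (\<sim> x \<sqinter> \<sim> y)"] x y by simp
qed (use x y in simp_all)

lemma compl_meet: "\<lbrakk>x \<in> carrier L; y \<in> carrier L\<rbrakk> \<Longrightarrow> \<sim> (x \<sqinter> y) = \<sim> x \<squnion> \<sim> y"
  using compl_join[of "\<sim> x" "\<sim> y"] compl_involution[of "\<sim> x \<squnion> \<sim> y"] by simp

text \<open>This is the orthomodular law for \<open>\<sim> x \<sqsubseteq> \<sim> y\<close>,
  complemented. It is the form that (R3) takes in \<open>\<bbbR> L\<close>.\<close>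

lemma orthomodular_dual:
  assumes x: "x \<in> carrier L" and y: "y \<in> carrier L" and "y \<sqsubseteq> x"
  shows "(y \<squnion> \<sim> x) \<sqinter> x = y"
proof -
  have "\<sim> x \<sqsubseteq> \<sim> y" using assms by (simp add: compl_antitone)
  then have "\<sim> y = \<sim> x \<squnion> (\<sim> y \<sqinter> x)"
    using orthomodular[of "\<sim> x" "\<sim> y"] x y by simp
  then have "y = \<sim> (\<sim> x \<squnion> (\<sim> y \<sqinter> x))" using y by (metis compl_involution)
  also have "\<dots> = (y \<squnion> \<sim> x) \<sqinter> x"
    using x y by (simp add: compl_join compl_meet meet_comm join_comm)
  finally show ?thesis by simp
qed

section \<open>From an orthomodular lattice to a specific RLSE and back\<close>

lemma ringlike_of_simps:
  "carrier (\<bbbR> L) = carrier L"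
  "\<zero>\<^bsub>\<bbbR> L\<^esub> = \<bottom>"
  "\<one>\<^bsub>\<bbbR> L\<^esub> = \<top>"
  "\<lbrakk>x \<in> carrier L; y \<in> carrier L\<rbrakk> \<Longrightarrow> x \<oplus>\<^bsub>\<bbbR> L\<^esub> y = (x \<sqinter> \<sim> y) \<squnion> (\<sim> x \<sqinter> y)"
  "\<lbrakk>x \<in> carrier L; y \<in> carrier L\<rbrakk> \<Longrightarrow> x \<otimes>\<^bsub>\<bbbR> L\<^esub> y = x \<sqinter> y"
  by (simp_all add: ringlike_of_def)

lemma ringlike_of_add_top: "x \<in> carrier L \<Longrightarrow> x \<oplus>\<^bsub>\<bbbR> L\<^esub> \<top> = \<sim> x"
  by (simp add: ringlike_of_simps)

text \<open>Orthogonality is symmetric, so \<open>a \<sqinter> \<sim> b\<close> and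
  \<open>\<sim> a \<sqinter> b\<close> reduce to \<open>a\<close> and \<open>b\<close>. Both (R4)
  and (R5) rest on this.\<close>

lemma ringlike_of_add_orthogonal:
  assumes a: "a \<in> carrier L" and b: "b \<in> carrier L" and "a \<sqsubseteq> \<sim> b"
  shows "a \<oplus>\<^bsub>\<bbbR> L\<^esub> b = a \<squnion> b"
proof -
  have "b \<sqsubseteq> \<sim> a"
    using compl_antitone[of a "\<sim> b"] assms by simp
  then show ?thesis
    using assms by (simp add: ringlike_of_simps ol_le_def meet_comm[of "\<sim> a"])
qed

lemma specific_rlse_ringlike_of: "specific_rlse (\<bbbR> L)"
proof (unfold_locales, unfold ringlike_of_simps(1-3), goal_cases)
  case 1 then show ?case unfolding ringlike_of_def by (simp add: restrict2_mem)
next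
  case 2 then show ?case unfolding ringlike_of_def by (simp add: restrict2_mem)
next
  case (5 x y z) then show ?case by (simp add: ringlike_of_simps meet_assoc)
next
  case (6 x y) then show ?case by (simp add: ringlike_of_simps meet_comm)
next
  case (7 x) then show ?case by (simp add: ringlike_of_simps)
next
  case (8 x) then show ?case by (simp add: ringlike_of_simps)
next
  case (9 x) then show ?case by (simp add: ringlike_of_simps)
next
  case (10 x y) then show ?case
    by (simp add: ringlike_of_simps meet_comm join_comm)
next
  \<comment> \<open>After De Morgan, (R2) is absorption.\<close>
  case (11 x y) then show ?case
    by (simp add: ringlike_of_add_top ringlike_of_simps(5) compl_meet[of "\<sim> (x \<sqinter> y)"]
        join_comm[of _ x] join_absorb)
next
  case (12 x y) then show ?case
    by (simp add: ringlike_of_add_top ringlike_of_simps(5) compl_meet[of "\<sim> (x \<sqinter> y)"]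
        orthomodular_dual meet_le1)
next
  \<comment> \<open>The summands of (R4) are orthogonal since
    \<open>x \<sqinter> y \<sqsubseteq> x\<close>; De Morgan gives the same join on the
    right.\<close>
  case (13 x y) then show ?case
    by (simp add: ringlike_of_add_top ringlike_of_simps(5) ringlike_of_add_orthogonal
        compl_meet[of "\<sim> (x \<sqinter> y)"] meet_le1)
next
  case (14 x y)
  have "x \<sqinter> \<sim> y \<sqsubseteq> x" using 14 by (simp add: meet_le1)
  moreover have "x \<sqsubseteq> \<sim> (\<sim> x \<sqinter> y)"
    using compl_antitone[OF _ _ meet_le1, of "\<sim> x" y] 14 by simp
  \<comment> \<open>The two joinands defining \<open>x + y\<close> are orthogonal, so their join is
    also their sum, as (R5) demands.\<close>
  ultimately have "x \<sqinter> \<sim> y \<sqsubseteq> \<sim> (\<sim> x \<sqinter> y)"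
    using le_trans[of "x \<sqinter> \<sim> y" x "\<sim> (\<sim> x \<sqinter> y)"] 14 by simp
  then have "(x \<sqinter> \<sim> y) \<oplus>\<^bsub>\<bbbR> L\<^esub> (\<sim> x \<sqinter> y) = x \<oplus>\<^bsub>\<bbbR> L\<^esub> y"
    using 14 by (simp add: ringlike_of_add_orthogonal ringlike_of_simps(4)[of x y])
  then show ?case
    using 14 by (simp add: ringlike_of_add_top ringlike_of_simps(5))
qed simp_all

text \<open>Adding \<open>\<top>\<close> in \<open>\<bbbR> L\<close> is complementation, so the join
  of \<open>\<bbbL> (\<bbbR> L)\<close> is the De Morgan expression for the join of
  \<open>L\<close>.\<close>

lemma lattice_of_ringlike_of: "\<bbbL> (\<bbbR> L) = L"
proof -
  have "ol_join (\<bbbL> (\<bbbR> L)) = ol_join L"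
    unfolding lattice_of_def
    by (rule funcset2_eqI[OF _ join_op])
      (simp_all add: ringlike_of_simps(1-3,5) ringlike_of_add_top compl_meet restrict2_mem)
  moreover have "ol_meet (\<bbbL> (\<bbbR> L)) = ol_meet L"
    unfolding lattice_of_def
    by (rule funcset2_eqI[OF _ meet_op]) (simp_all add: ringlike_of_simps restrict2_mem)
  moreover have "ol_compl (\<bbbL> (\<bbbR> L)) = ol_compl L"
    unfolding lattice_of_def
    by (rule PiE_ext[OF _ compl_op]) (auto simp: ringlike_of_simps(1-3) ringlike_of_add_top)
  ultimately show ?thesis
    by (simp add: lattice_of_def ringlike_of_simps)
qed

end

theorem theorem2p4:
  fixes R :: "'a ringlike_alg" and L :: "'b ortho_alg"
  assumes "specific_rlse R" and "orthomodular_alg L"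
  shows "orthomodular_alg (\<bbbL> R) \<and>
    specific_rlse (\<bbbR> L) \<and>
    \<bbbR> (\<bbbL> R) = R \<and>
    \<bbbL> (\<bbbR> L) = L"
  using assms specific_rlse.axioms(1) rlse.orthomodular_alg_lattice_of
    specific_rlse.ringlike_of_lattice_of orthomodular_alg.specific_rlse_ringlike_of
    orthomodular_alg.lattice_of_ringlike_of
  by blast

end
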